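(* Let $R$ be a Dedekind-finite, von Neumann regular ring satisfying the comparability axiom, and let $a$ be an $\mathrm{r.Fix}_R$-irreducible of the monoid $R^\#$ of zero divisors of $R$. Then $a$ is a coprimitive idempotent of $R$.
   Context: Rings are associative, non-zero, with identity $1_R$, not necessarily commutative. $R$ is von Neumann regular if for each $x \in R$ there is $y \in R$ with $x = xyx$; Dedekind-finite if $xy = 1_R$ implies $yx = 1_R$. A von Neumann regular ring $R$ satisfies the comparability axiom if, for all $u, v \in R$, there is an injective homomorphism of right $R$-modules either from $uR$ to $vR$ or from $vR$ to $uR$. The monoid of zero divisors $R^\#$ is the multiplicative submonoid of $R$ consisting of $1_R$ and of all $a \in R$ that are both left and right zero divisors, i.e. $ax = 0$ and $ya = 0$ for some non-zero $x, y \in R$. For $a \in R$, $\mathrm{r.ann}(a) := \{x \in R : ax = 0\}$ and $\mathrm{r.Fix}(a) := \{x \in R : ax = x\}$. The $\mathrm{r.Fix}_R$-preorder on $R^\#$ is defined by $b \preceq c$ iff $\mathrm{r.Fix}(c) \subseteq \mathrm{r.Fix}(b)$; write $b \prec c$ if $b \preceq c$ and $c \not\preceq b$. The only $\mathrm{r.Fix}_R$-unit (element $u$ with $u \preceq 1_R \preceq u$) is $1_R$; all other elements of $R^\#$ are $\mathrm{r.Fix}_R$-non-units. An $\mathrm{r.Fix}_R$-irreducible of $R^\#$ (i.e. of degree $2$) is an $\mathrm{r.Fix}_R$-non-unit $a \in R^\#$ that cannot be written as $a = bc$ with $\mathrm{r.Fix}_R$-non-units $b, c \in R^\#$ satisfying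 $b \prec a$ and $c \prec a$. An idempotent $e \in R$ is coprimitive if $\mathrm{r.ann}(e)$ is an indecomposable submodule of $R_R$ (non-zero and not the direct sum of two non-zero submodules). *)

theory Defs
  imports Main
begin

text \<open>
  Rings are the types of class \<^class>\<open>ring_1\<close>: associative, with identity, non-zero
  (\<open>0 \<noteq> 1\<close>), not necessarily commutative. Ring-level properties take the type as an argument.
\<close>

definition von_neumann_regular :: "'a::ring_1 itself \<Rightarrow> bool" where
  "von_neumann_regular _ \<longleftrightarrow> (\<forall>x::'a. \<exists>y. x = x * y * x)"

definition dedekind_finite :: "'a::ring_1 itself \<Rightarrow> bool" where
  "dedekind_finite _ \<longleftrightarrow> (\<forall>x y::'a. x * y = 1 \<longrightarrow> y * x = 1)"


subsection \<open>Submodules of the right regular module\<close>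

text \<open>Closure under negation follows from closure under right multiplication by \<open>-1\<close>.\<close>

definition right_submodule :: "'a::ring_1 set \<Rightarrow> bool" where
  "right_submodule M \<longleftrightarrow>
     0 \<in> M \<and> (\<forall>x\<in>M. \<forall>y\<in>M. x + y \<in> M) \<and> (\<forall>x\<in>M. \<forall>r. x * r \<in> M)"

definition principal_right :: "'a::ring_1 \<Rightarrow> 'a set" where
  "principal_right u = range (\<lambda>r. u * r)"

definition right_module_hom :: "'a::ring_1 set \<Rightarrow> 'a set \<Rightarrow> ('a \<Rightarrow> 'a) \<Rightarrow> bool" where
  "right_module_hom M N f \<longleftrightarrow>
     f ` M \<subseteq> N \<and>
     (\<forall>x\<in>M. \<forall>y\<in>M. f (x + y) = f x + f y) \<and>
     (\<forall>x\<in>M. \<forall>r. f (x * r) = f x * r)"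

definition right_embeds :: "'a::ring_1 set \<Rightarrow> 'a set \<Rightarrow> bool" where
  "right_embeds M N \<longleftrightarrow> (\<exists>f. right_module_hom M N f \<and> inj_on f M)"

definition comparability_axiom :: "'a::ring_1 itself \<Rightarrow> bool" where
  "comparability_axiom _ \<longleftrightarrow>
     (\<forall>u v::'a. right_embeds (principal_right u) (principal_right v) \<or>
                right_embeds (principal_right v) (principal_right u))"

definition is_direct_sum :: "'a::ring_1 set \<Rightarrow> 'a set \<Rightarrow> 'a set \<Rightarrow> bool" where
  "is_direct_sum M A B \<longleftrightarrow> M = {x + y | x y. x \<in> A \<and> y \<in> B} \<and> A \<inter> B = {0}"

definition indecomposable_submodule :: "'a::ring_1 set \<Rightarrow> bool" where
  "indecomposable_submodule M \<longleftrightarrow>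
     right_submodule M \<and> M \<noteq> {0} \<and>
     \<not> (\<exists>A B. right_submodule A \<and> right_submodule B \<and> A \<noteq> {0} \<and> B \<noteq> {0} \<and> is_direct_sum M A B)"


subsection \<open>The monoid of zero divisors and the preorder on it\<close>

definition zero_divisor_monoid :: "'a::ring_1 set" where
  "zero_divisor_monoid = {1} \<union> {a. (\<exists>x. x \<noteq> 0 \<and> a * x = 0) \<and> (\<exists>y. y \<noteq> 0 \<and> y * a = 0)}"

definition r_ann :: "'a::ring_1 \<Rightarrow> 'a set" where
  "r_ann a = {x. a * x = 0}"

definition r_Fix :: "'a::ring_1 \<Rightarrow> 'a set" where
  "r_Fix a = {x. a * x = x}"

definition r_Fix_le :: "'a::ring_1 \<Rightarrow> 'a \<Rightarrow> bool" where
  "r_Fix_le b c \<longleftrightarrow> r_Fix c \<subseteq> r_Fix b"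

definition r_Fix_less :: "'a::ring_1 \<Rightarrow> 'a \<Rightarrow> bool" where
  "r_Fix_less b c \<longleftrightarrow> r_Fix_le b c \<and> \<not> r_Fix_le c b"

definition r_Fix_unit :: "'a::ring_1 \<Rightarrow> bool" where
  "r_Fix_unit u \<longleftrightarrow> u \<in> zero_divisor_monoid \<and> r_Fix_le u 1 \<and> r_Fix_le 1 u"

definition r_Fix_nonunit :: "'a::ring_1 \<Rightarrow> bool" where
  "r_Fix_nonunit u \<longleftrightarrow> u \<in> zero_divisor_monoid \<and> \<not> r_Fix_unit u"

definition r_Fix_irreducible :: "'a::ring_1 \<Rightarrow> bool" where
  "r_Fix_irreducible a \<longleftrightarrow>
     r_Fix_nonunit a \<and>
     \<not> (\<exists>b c. r_Fix_nonunit b \<and> r_Fix_nonunit c \<and> r_Fix_less b a \<and> r_Fix_less c a \<and> a = b * c)"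

definition coprimitive_idempotent :: "'a::ring_1 \<Rightarrow> bool" where
  "coprimitive_idempotent e \<longleftrightarrow> e * e = e \<and> indecomposable_submodule (r_ann e)"


subsection \<open>Basic facts\<close>

lemma right_submodule_r_ann: "right_submodule (r_ann a)"
  by (auto simp: right_submodule_def r_ann_def distrib_left simp flip: mult.assoc)

lemma right_submodule_principal_right: "right_submodule (principal_right u)"
  unfolding right_submodule_def principal_right_def
  by (auto simp: image_iff mult.assoc simp flip: distrib_left) (metis mult_zero_right)

lemma zero_divisor_monoid_mult:
  assumes "a \<in> zero_divisor_monoid" "b \<in> zero_divisor_monoid"
  shows "a * b \<in> zero_divisor_monoid"
proof (cases "a = 1 \<or> b = 1")
  case True
  then show ?thesis using assms by auto
next
  case False
  then obtain x y where "x \<noteq> 0" "b * x = 0" "y \<noteq> 0" "y * a = 0"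
    using assms by (auto simp: zero_divisor_monoid_def)
  then have "a * b * x = 0" "y * (a * b) = 0"
    by (simp add: mult.assoc, simp flip: mult.assoc)
  with \<open>x \<noteq> 0\<close> \<open>y \<noteq> 0\<close> show ?thesis
    by (auto simp: zero_divisor_monoid_def)
qed

lemma r_Fix_unit_iff: "r_Fix_unit (u::'a::ring_1) \<longleftrightarrow> u = 1"
proof
  assume "r_Fix_unit u"
  then have "r_Fix 1 \<subseteq> r_Fix u" by (simp add: r_Fix_unit_def r_Fix_le_def)
  moreover have "1 \<in> r_Fix (1::'a)" by (simp add: r_Fix_def)
  ultimately have "1 \<in> r_Fix u" by blast
  then show "u = 1" by (simp add: r_Fix_def)
qed (simp add: r_Fix_unit_def r_Fix_le_def zero_divisor_monoid_def)

end

theory Submission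
  imports Defs
begin

text \<open>
  In a Dedekind-finite regular ring every left or right zero divisor is two-sided, so an
  element of the monoid other than \<open>1\<close> is just a non-invertible element. Let \<open>K\<close> be the right
  annihilator of \<open>a\<close> and \<open>F\<close> its right fixer. If \<open>e\<close> is an idempotent with kernel inside \<open>K\<close> and
  image containing \<open>F\<close>, then \<open>a = a e = b e\<close> for every \<open>b\<close> that agrees with \<open>a\<close> on the image of
  \<open>e\<close>, and the values of \<open>b\<close> on the kernel of \<open>e\<close> are free.

  If \<open>K\<close> splits as \<open>A \<oplus> B\<close>, take \<open>e\<close> with kernel \<open>A\<close> and let \<open>b\<close> be the identity on \<open>A\<close>; then \<open>b\<close>
  still kills \<open>B\<close>. Hence \<open>K\<close> is indecomposable, and so simple by regularity. If \<open>a\<close> is not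
  idempotent, its image is \<open>F \<oplus> L\<close> with \<open>L \<noteq> 0\<close>, and comparability provides a copy \<open>J\<close> of \<open>K\<close>
  inside \<open>L\<close>. The modules \<open>F \<oplus> K\<close> and \<open>F \<oplus> J\<close> have a common complement \<open>H\<close>; with \<open>e\<close> the
  projection onto \<open>F \<oplus> H\<close> along \<open>K\<close>, the element \<open>b\<close> agreeing with \<open>a\<close> on \<open>F \<oplus> H\<close> and with the
  identity on \<open>J\<close> has image inside that of \<open>a\<close>, so it is not invertible. Either way \<open>a = b e\<close>
  contradicts irreducibility.
\<close>

section \<open>Zero divisors and non-trivial factorizations\<close>

text \<open>If \<open>a = a * y * a\<close>, then \<open>1 - y * a\<close> and
  \<open>1 - a * y\<close> annihilate \<open>a\<close> on the right and on the left. By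
  Dedekind-finiteness neither vanishes once \<open>a\<close> is a zero divisor on either
  side.\<close>

lemma right_zero_divisor_iff_left:
  fixes a :: "'a::ring_1"
  assumes df: "dedekind_finite TYPE('a)" and reg: "von_neumann_regular TYPE('a)"
  shows "(\<exists>x. x \<noteq> 0 \<and> a * x = 0) \<longleftrightarrow> (\<exists>y. y \<noteq> 0 \<and> y * a = 0)"
proof -
  obtain y where y: "a * y * a = a"
    using reg unfolding von_neumann_regular_def by metis
  have l: "a * (1 - y * a) = 0" and r: "(1 - a * y) * a = 0"
    using y by (simp_all add: algebra_simps)
  have fin: "u * v = 1 \<Longrightarrow> v * u = 1" for u v :: 'a
    using df unfolding dedekind_finite_def by blast
  show ?thesis
  proof
    assume "\<exists>x. x \<noteq> 0 \<and> a * x = 0"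
    then obtain x where x: "x \<noteq> 0" "a * x = 0" by blast
    have "a * y \<noteq> 1"
      using x fin[of a y] by (metis mult.assoc mult_1_left mult_zero_right)
    then show "\<exists>y. y \<noteq> 0 \<and> y * a = 0" using r by (metis right_minus_eq)
  next
    assume "\<exists>y. y \<noteq> 0 \<and> y * a = 0"
    then obtain x where x: "x \<noteq> 0" "x * a = 0" by blast
    have "y * a \<noteq> 1"
      using x fin[of y a] by (metis mult.assoc mult_1_right mult_zero_left)
    then show "\<exists>x. x \<noteq> 0 \<and> a * x = 0" using l by (metis right_minus_eq)
  qed
qed

lemma r_Fix_nonunit_iff:
  "r_Fix_nonunit (a::'a::ring_1) \<longleftrightarrow> (\<exists>x. x \<noteq> 0 \<and> a * x = 0) \<and> (\<exists>y. y \<noteq> 0 \<and> y * a = 0)"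
  by (auto simp: r_Fix_nonunit_def r_Fix_unit_iff zero_divisor_monoid_def)

lemma r_Fix_irreducible_no_idempotent_factor:
  fixes a b e :: "'a::ring_1"
  assumes df: "dedekind_finite TYPE('a)" and reg: "von_neumann_regular TYPE('a)"
    and irr: "r_Fix_irreducible a"
    and e: "e * e = e" "e \<noteq> 1" "e \<noteq> a"
    and fix_e: "\<And>x. a * x = x \<Longrightarrow> e * x = x"
    and be: "b * e = a"
    and sing: "(\<exists>x. x \<noteq> 0 \<and> b * x = 0) \<or> (\<exists>y. y \<noteq> 0 \<and> y * b = 0)"
    and z: "b * z = z" "a * z \<noteq> z"
  shows False
proof -
  have "e * (1 - e) = 0" "(1 - e) * e = 0" "1 - e \<noteq> 0"
    using e by (simp_all add: algebra_simps)
  then have nu_e: "r_Fix_nonunit e" unfolding r_Fix_nonunit_iff by blast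
  have nu_b: "r_Fix_nonunit b"
    using sing right_zero_divisor_iff_left[OF df reg, of b] unfolding r_Fix_nonunit_iff by blast
  have "b * x = x" if "a * x = x" for x
    using fix_e[OF that] that be by (metis mult.assoc)
  then have less_b: "r_Fix_less b a"
    using z by (auto simp: r_Fix_less_def r_Fix_le_def r_Fix_def)
  \<comment> \<open>Here \<open>a * e = b * e * e = a\<close>, so \<open>a * e = e\<close> would
    give \<open>e = a\<close>.\<close>
  have "a * e \<noteq> e"
    using e(1,3) be by (metis mult.assoc)
  then have less_e: "r_Fix_less e a"
    using e(1) fix_e by (auto simp: r_Fix_less_def r_Fix_le_def r_Fix_def)
  show False
    using irr nu_b nu_e less_b less_e be unfolding r_Fix_irreducible_def by blast
qed

section \<open>Projections onto annihilators and fixers\<close>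

lemma regular_r_ann_projection:
  fixes a :: "'a::ring_1"
  assumes "von_neumann_regular TYPE('a)"
  obtains p where "p * p = p" "a * p = 0"
    "\<And>x. a * x = 0 \<Longrightarrow> p * x = x" "\<And>x. a * x = x \<Longrightarrow> p * x = 0"
proof -
  obtain y where y: "a * y * a = a"
    using assms unfolding von_neumann_regular_def by metis
  define k where "k = 1 - y * a"
  have ak: "a * k = 0"
    unfolding k_def using y by (simp add: algebra_simps)
  have kx: "k * x = x" if "a * x = 0" for x
    unfolding k_def using that by (simp add: left_diff_distrib mult.assoc)
  \<comment> \<open>\<open>k\<close> alone already projects onto the annihilator; the factor
    \<open>1 - a\<close> is the identity there and makes \<open>p\<close> kill the fixer as
    well.\<close>
  define p where "p = k * (1 - a)"
  show thesis
  proof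
    show p_ann: "p * x = x" if "a * x = 0" for x
      unfolding p_def using that kx[OF that] by (simp add: mult.assoc left_diff_distrib)
    show ap: "a * p = 0"
      unfolding p_def using ak by (simp flip: mult.assoc)
    show "p * p = p" by (rule p_ann[OF ap])
    show "p * x = 0" if "a * x = x" for x
      unfolding p_def using that by (simp add: mult.assoc left_diff_distrib)
  qed
qed

text \<open>The fixer of \<open>a\<close> is the right annihilator of \<open>1 - a\<close>.\<close>

lemma regular_r_Fix_projection:
  fixes a :: "'a::ring_1"
  assumes "von_neumann_regular TYPE('a)"
  obtains f where "a * f = f" "\<And>x. a * x = x \<longleftrightarrow> f * x = x"
proof -
  obtain f where f: "(1 - a) * f = 0" "\<And>x. (1 - a) * x = 0 \<Longrightarrow> f * x = x"
    using regular_r_ann_projection[OF assms, of "1 - a"] by metis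
  have af: "a * f = f" using f(1) by (simp add: left_diff_distrib)
  have "a * x = x \<longleftrightarrow> f * x = x" for x
  proof
    assume "a * x = x"
    then show "f * x = x" using f(2)[of x] by (simp add: left_diff_distrib)
  next
    assume "f * x = x"
    then show "a * x = x" using af by (metis mult.assoc)
  qed
  with af show thesis by (rule that)
qed

section \<open>Simplicity of the right annihilator\<close>

lemma r_Fix_irreducible_r_ann_indecomposable:
  fixes a :: "'a::ring_1"
  assumes df: "dedekind_finite TYPE('a)" and reg: "von_neumann_regular TYPE('a)"
    and irr: "r_Fix_irreducible a"
  shows "indecomposable_submodule (r_ann a)"
proof -
  have nz: "r_ann a \<noteq> {0}"
    using irr by (auto simp: r_Fix_irreducible_def r_Fix_nonunit_iff r_ann_def)
  obtain p where p: "p * p = p" "a * p = 0"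
    and p_ann: "\<And>x. a * x = 0 \<Longrightarrow> p * x = x" and p_fix: "\<And>x. a * x = x \<Longrightarrow> p * x = 0"
    using regular_r_ann_projection[OF reg, of a] by metis
  have False if A: "right_submodule A" and B: "right_submodule B"
    and ne: "A \<noteq> {0}" "B \<noteq> {0}" and sum: "is_direct_sum (r_ann a) A B" for A B
  proof -
    have ab: "a * (x + y) = 0" if "x \<in> A" "y \<in> B" for x y
      using sum that unfolding is_direct_sum_def r_ann_def by blast
    have zero: "0 \<in> A" "0 \<in> B" using A B by (auto simp: right_submodule_def)
    have annA: "a * x = 0" if "x \<in> A" for x using ab[OF that zero(2)] by simp
    have annB: "a * x = 0" if "x \<in> B" for x using ab[OF zero(1) that] by simp
    have mulA: "x * r \<in> A" if "x \<in> A" for x r using A that by (auto simp: right_submodule_def)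
    have mulB: "x * r \<in> B" if "x \<in> B" for x r using B that by (auto simp: right_submodule_def)
    have uniq: "x = x' \<and> y = y'"
      if "x \<in> A" "x' \<in> A" "y \<in> B" "y' \<in> B" "x + y = x' + y'" for x x' y y'
    proof -
      have "x + x' * (- 1) \<in> A" using A that mulA unfolding right_submodule_def by blast
      moreover have "y' + y * (- 1) \<in> B" using B that mulB unfolding right_submodule_def by blast
      moreover have eq: "x - x' = y' - y" using that(5) by (simp add: algebra_simps)
      ultimately have "x - x' \<in> A \<inter> B" by simp
      then have "x - x' = 0" using sum unfolding is_direct_sum_def by blast
      then show ?thesis using eq by simp
    qed
    \<comment> \<open>The component \<open>u\<close> of \<open>p\<close> in \<open>A\<close> is an
      idempotent with image \<open>A\<close>; it kills \<open>B\<close> and, through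
      \<open>u * p = u\<close>, the fixer of \<open>a\<close>. Each identity comes from comparing
      components in \<open>A\<close> and \<open>B\<close>.\<close>
    have "p \<in> r_ann a" using p by (simp add: r_ann_def)
    then obtain u v where uv: "u \<in> A" "v \<in> B" "p = u + v"
      using sum by (auto simp: is_direct_sum_def)
    have "u * p + v * p = u + v" using p uv by (simp add: distrib_right)
    then have up: "u * p = u" using uniq uv mulA mulB by blast
    have "u * u + v * u = u + 0" using p_ann[OF annA[OF uv(1)]] uv by (simp add: distrib_right)
    then have uu: "u * u = u" using uniq uv zero mulA mulB by blast
    have "u * v + v * v = 0 + v" using p_ann[OF annB[OF uv(2)]] uv by (simp add: distrib_right)
    then have uv0: "u * v = 0" using uniq uv zero mulA mulB by blast
    have u0: "u \<noteq> 0"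
    proof
      assume "u = 0"
      obtain x where x: "x \<in> A" "x \<noteq> 0" using ne(1) zero by blast
      have "x + 0 = 0 + v * x" using p_ann[OF annA[OF x(1)]] uv \<open>u = 0\<close> by simp
      then have "x = 0" using uniq x uv zero mulB by blast
      with x show False by simp
    qed
    have v0: "v \<noteq> 0"
    proof
      assume "v = 0"
      obtain x where x: "x \<in> B" "x \<noteq> 0" using ne(2) zero by blast
      have "0 + x = u * x + 0" using p_ann[OF annB[OF x(1)]] uv \<open>v = 0\<close> by simp
      then have "x = 0" using uniq x uv zero mulA by blast
      with x show False by simp
    qed
    have au: "a * u = 0" and av: "a * v = 0" using annA annB uv by auto
    show False
    proof (rule r_Fix_irreducible_no_idempotent_factor[OF df reg irr])
      show "(1 - u) * (1 - u) = 1 - u" using uu by (simp add: algebra_simps)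
      show "1 - u \<noteq> 1" using u0 by simp
      show "1 - u \<noteq> a"
      proof
        assume "1 - u = a"
        then have "a * v = v" using uv0 by (auto simp: left_diff_distrib)
        then show False using av v0 by simp
      qed
      show "(1 - u) * x = x" if "a * x = x" for x
      proof -
        have "u * x = 0" using up p_fix[OF that] by (metis mult.assoc mult_zero_right)
        then show ?thesis by (simp add: left_diff_distrib)
      qed
      show "(a + u) * (1 - u) = a" using uu au by (simp add: algebra_simps)
      show "(\<exists>x. x \<noteq> 0 \<and> (a + u) * x = 0) \<or> (\<exists>y. y \<noteq> 0 \<and> y * (a + u) = 0)"
        using v0 av uv0 by (metis add_0 distrib_right)
      show "(a + u) * u = u" using au uu by (simp add: distrib_right)
      show "a * u \<noteq> u" using au u0 by simp
    qed
  qed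
  then show ?thesis
    using nz right_submodule_r_ann unfolding indecomposable_submodule_def by blast
qed

text \<open>By regularity \<open>x * y\<close> is an idempotent with image \<open>x R\<close>, so
  \<open>x R\<close> is a direct summand of the annihilator, and indecomposability makes it
  everything.\<close>

lemma regular_indecomposable_r_ann_simple:
  fixes a :: "'a::ring_1"
  assumes reg: "von_neumann_regular TYPE('a)"
    and ind: "indecomposable_submodule (r_ann a)"
    and x: "a * x = 0" "x \<noteq> 0" and v: "a * v = 0"
  shows "\<exists>r. x * r = v"
proof -
  obtain y where y: "x * y * x = x"
    using reg unfolding von_neumann_regular_def by metis
  define B where "B = r_ann a \<inter> r_ann (x * y)"
  have split: "v = x * (y * v) + (v - x * (y * v))"
    "v - x * (y * v) \<in> B" if "a * v = 0" for v
  proof -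
    have "a * (x * (y * v)) = 0" using x(1) by (simp flip: mult.assoc)
    moreover have "x * y * (x * (y * v)) = x * (y * v)" using y by (simp flip: mult.assoc)
    ultimately show "v = x * (y * v) + (v - x * (y * v))" "v - x * (y * v) \<in> B"
      using that by (simp_all add: B_def r_ann_def right_diff_distrib mult.assoc)
  qed
  have subB: "right_submodule B"
    using right_submodule_r_ann[of a] right_submodule_r_ann[of "x * y"]
    unfolding B_def right_submodule_def by blast
  have "is_direct_sum (r_ann a) (principal_right x) B"
    unfolding is_direct_sum_def
  proof
    show "r_ann a = {s + t |s t. s \<in> principal_right x \<and> t \<in> B}" (is "_ = ?S")
    proof
      show "r_ann a \<subseteq> ?S"
        using split by (force simp: r_ann_def principal_right_def)
      show "?S \<subseteq> r_ann a"
        using x(1) by (auto simp: B_def r_ann_def principal_right_def distrib_left simp flip: mult.assoc)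
    qed
    have "x * r = 0" if "x * y * (x * r) = 0" for r
      using that y by (metis mult.assoc)
    moreover have "0 \<in> B" "0 \<in> principal_right x"
      using subB right_submodule_principal_right by (auto simp: right_submodule_def)
    ultimately show "principal_right x \<inter> B = {0}"
      by (auto simp: B_def r_ann_def principal_right_def)
  qed
  moreover have "x \<in> principal_right x"
    unfolding principal_right_def by (metis mult_1_right rangeI)
  then have "principal_right x \<noteq> {0}" using x(2) by auto
  ultimately have "B = {0}"
    using ind subB right_submodule_principal_right[of x]
    unfolding indecomposable_submodule_def by blast
  then have "v = x * (y * v)" using split[OF v] by simp
  then show ?thesis by metis
qed

section \<open>Embeddings of a simple module and common complements\<close>

text \<open>Since \<open>p R\<close> is simple, left multiplication by \<open>t\<close> is injective on it, and regularity turns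
  injectivity into a left inverse.\<close>

lemma regular_simple_left_inverse:
  fixes p t :: "'a::ring_1"
  assumes reg: "von_neumann_regular TYPE('a)"
    and simple: "\<And>x. p * x = x \<Longrightarrow> x \<noteq> 0 \<Longrightarrow> \<exists>r. x * r = p"
    and p: "p * p = p" and t: "t * p = t" "t \<noteq> 0"
  obtains i where "p * i = i" "i * t = p"
proof -
  obtain y where y: "t * y * t = t"
    using reg unfolding von_neumann_regular_def by metis
  \<comment> \<open>The defect of \<open>p * y\<close> as a left inverse of \<open>t\<close>: it
    lies in \<open>p R\<close> and is killed by \<open>t\<close>.\<close>
  define x where "x = p - p * y * t"
  have px: "p * x = x" unfolding x_def using p by (simp add: right_diff_distrib flip: mult.assoc)
  have tx: "t * x = 0" unfolding x_def using t y by (simp add: right_diff_distrib flip: mult.assoc)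
  have "x = 0"
  proof (rule ccontr)
    assume "x \<noteq> 0"
    then obtain r where "x * r = p" using simple px by blast
    then show False using tx t by (metis mult.assoc mult_zero_left)
  qed
  then have "(p * y) * t = p" by (simp add: x_def)
  moreover have "p * (p * y) = p * y" using p by (simp flip: mult.assoc)
  ultimately show thesis by (rule that[rotated])
qed

text \<open>An embedding of \<open>p R\<close> into \<open>l R\<close> sends \<open>p\<close> to the
  required \<open>l * s\<close>. An embedding the other way is onto, as \<open>p R\<close> is
  simple, and the preimage of \<open>p\<close> serves.\<close>

lemma comparability_nonzero_hom_from_simple:
  fixes p l :: "'a::ring_1"
  assumes cmp: "comparability_axiom TYPE('a)"
    and simple: "\<And>x. p * x = x \<Longrightarrow> x \<noteq> 0 \<Longrightarrow> \<exists>r. x * r = p"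
    and p: "p * p = p" "p \<noteq> 0" and l: "l \<noteq> 0"
  obtains s where "l * s * p = l * s" "l * s \<noteq> 0"
proof -
  have mem: "x \<in> principal_right x" "0 \<in> principal_right x" for x :: 'a
    unfolding principal_right_def by (metis mult_1_right rangeI, metis mult_zero_right rangeI)
  have hom0: "\<phi> 0 = 0" if "right_module_hom (principal_right u) N \<phi>" for u :: 'a and N \<phi>
    using that mem(2)[of u] unfolding right_module_hom_def by (metis mult_zero_right)
  consider "right_embeds (principal_right p) (principal_right l)"
    | "right_embeds (principal_right l) (principal_right p)"
    using cmp unfolding comparability_axiom_def by blast
  then show thesis
  proof cases
    case 1
    then obtain \<phi> where \<phi>: "right_module_hom (principal_right p) (principal_right l) \<phi>"
      and inj: "inj_on \<phi> (principal_right p)"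
      unfolding right_embeds_def by blast
    have "\<phi> p \<in> principal_right l" using \<phi> mem by (auto simp: right_module_hom_def)
    then obtain s where s: "\<phi> p = l * s" by (auto simp: principal_right_def)
    have "\<phi> (p * p) = \<phi> p * p" using \<phi> mem(1)[of p] by (auto simp: right_module_hom_def)
    then have "l * s * p = l * s" using p s by simp
    moreover have "\<phi> p \<noteq> \<phi> 0" using inj mem[of p] p(2) by (auto dest: inj_onD)
    then have "l * s \<noteq> 0" using hom0[OF \<phi>] s by simp
    ultimately show thesis by (rule that)
  next
    case 2
    then obtain \<phi> where \<phi>: "right_module_hom (principal_right l) (principal_right p) \<phi>"
      and inj: "inj_on \<phi> (principal_right l)"
      unfolding right_embeds_def by blast
    have "\<phi> l \<in> principal_right p" using \<phi> mem by (auto simp: right_module_hom_def)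
    then have "p * \<phi> l = \<phi> l" using p(1) by (auto simp: principal_right_def simp flip: mult.assoc)
    moreover have "\<phi> l \<noteq> \<phi> 0" using inj mem[of l] l by (auto dest: inj_onD)
    then have "\<phi> l \<noteq> 0" using hom0[OF \<phi>] by simp
    ultimately obtain r where r: "\<phi> l * r = p" using simple by blast
    have "\<phi> (l * (r * p)) = \<phi> l * (r * p)" using \<phi> mem(1)[of l] by (auto simp: right_module_hom_def)
    also have "\<dots> = p" using r p by (simp flip: mult.assoc)
    finally have "l * (r * p) \<noteq> 0" using hom0[OF \<phi>] p(2) by auto
    moreover have "l * (r * p) * p = l * (r * p)" using p(1) by (simp add: mult.assoc)
    ultimately show thesis by (rule that[rotated])
  qed
qed

text \<open>The module \<open>j R\<close> is a copy of \<open>p R\<close> that meets \<open>f R\<close> trivially, and the idempotent \<open>q\<close> is the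
  projection onto \<open>p R\<close> along the sum of \<open>f R\<close> and a common complement of \<open>f R \<oplus> p R\<close> and
  \<open>f R \<oplus> j R\<close>.\<close>

lemma regular_common_complement:
  fixes p f j :: "'a::ring_1"
  assumes reg: "von_neumann_regular TYPE('a)"
    and simple: "\<And>x. p * x = x \<Longrightarrow> x \<noteq> 0 \<Longrightarrow> \<exists>r. x * r = p"
    and p: "p * p = p" "p * f = 0" and f: "f * f = f"
    and j: "j * p = j" "j \<noteq> 0" "f * j = 0"
  obtains q i where "q * q = q" "p * q = q" "q * p = p" "q * f = 0" "i * q * j = p"
proof (cases "p * j = 0")
  case False
  have "p * j * p = p * j" using j by (simp add: mult.assoc)
  then obtain i where "i * (p * j) = p"
    using regular_simple_left_inverse[OF reg simple p(1)] False by metis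
  with p show thesis using that[of p i] by (simp add: mult.assoc)
next
  case True
  obtain i where i: "p * i = i" "i * j = p"
    using regular_simple_left_inverse[OF reg simple p(1) j(1,2)] by metis
  \<comment> \<open>\<open>n\<close> kills \<open>f\<close> and \<open>p\<close> but fixes
    \<open>j\<close>, so adding \<open>i * n\<close> to \<open>p\<close> keeps the values on
    \<open>f\<close> and \<open>p\<close> and sends \<open>j\<close> to
    \<open>i * j = p\<close>.\<close>
  define n where "n = (1 - f) * (1 - p)"
  have nj: "n * j = j" unfolding n_def using True j by (simp add: mult.assoc left_diff_distrib)
  have nf: "n * f = 0" unfolding n_def using p f by (simp add: mult.assoc left_diff_distrib)
  have np: "n * p = 0" unfolding n_def using p by (simp add: mult.assoc left_diff_distrib)
  define q where "q = p + i * n"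
  have pq: "p * q = q" unfolding q_def using i p by (simp add: distrib_left flip: mult.assoc)
  have qp: "q * p = p" unfolding q_def using np p by (simp add: distrib_right mult.assoc)
  have "q * q = q" using pq qp by (metis mult.assoc)
  moreover have "q * f = 0" unfolding q_def using nf p by (simp add: distrib_right mult.assoc)
  moreover have "1 * q * j = p"
    unfolding q_def using nj i True by (simp add: distrib_right mult.assoc)
  ultimately show thesis using pq qp that by blast
qed

section \<open>Idempotence of irreducibles\<close>

lemma r_Fix_irreducible_idempotent:
  fixes a :: "'a::ring_1"
  assumes df: "dedekind_finite TYPE('a)" and reg: "von_neumann_regular TYPE('a)"
    and cmp: "comparability_axiom TYPE('a)" and irr: "r_Fix_irreducible a"
  shows "a * a = a"
proof (rule ccontr)
  assume nid: "a * a \<noteq> a"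
  note ind = r_Fix_irreducible_r_ann_indecomposable[OF df reg irr]
  obtain p where p: "p * p = p" and ap: "a * p = 0"
    and p_ann: "\<And>x. a * x = 0 \<Longrightarrow> p * x = x" and p_fix: "\<And>x. a * x = x \<Longrightarrow> p * x = 0"
    using regular_r_ann_projection[OF reg, of a] by metis
  obtain f where af: "a * f = f" and f_fix: "\<And>x. a * x = x \<longleftrightarrow> f * x = x"
    using regular_r_Fix_projection[OF reg, of a] by metis
  have ff: "f * f = f" using af f_fix by blast
  have pf: "p * f = 0" by (rule p_fix[OF af])
  obtain x0 y0 where x0: "x0 \<noteq> 0" "a * x0 = 0" and y0: "y0 \<noteq> 0" "y0 * a = 0"
    using irr by (auto simp: r_Fix_irreducible_def r_Fix_nonunit_iff)
  have p0: "p \<noteq> 0" using p_ann x0 by force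
  have simple: "\<exists>r. x * r = p" if "p * x = x" "x \<noteq> 0" for x
  proof -
    have "a * x = 0" using that ap by (metis mult.assoc mult_zero_left)
    then show ?thesis using regular_indecomposable_r_ann_simple[OF reg ind _ that(2) ap] by blast
  qed
  define l where "l = a - f * a"
  have fl: "f * l = 0" unfolding l_def using ff by (simp add: right_diff_distrib flip: mult.assoc)
  have "l \<noteq> 0" unfolding l_def using nid f_fix[of a] by auto
  then obtain s where s: "l * s * p = l * s" "l * s \<noteq> 0"
    using comparability_nonzero_hom_from_simple[OF cmp simple p p0] by metis
  define j where "j = l * s"
  have j: "j * p = j" "j \<noteq> 0" "f * j = 0"
    unfolding j_def using s fl by (simp_all flip: mult.assoc)
  \<comment> \<open>\<open>y0\<close> annihilates the image of \<open>a\<close>, which contains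
    \<open>f R\<close> and \<open>j R\<close>; hence it will annihilate \<open>b\<close>
    too.\<close>
  have "y0 * l = 0"
  proof -
    have "y0 * (f * a) = y0 * a * (f * a)" using af by (metis mult.assoc)
    then show ?thesis unfolding l_def using y0 by (simp add: right_diff_distrib)
  qed
  then have y0j: "y0 * j = 0" unfolding j_def by (simp flip: mult.assoc)
  obtain q i where q: "q * q = q" "p * q = q" "q * p = p" "q * f = 0" "i * q * j = p"
    using regular_common_complement[OF reg simple p pf ff j] by metis
  have aq: "a * q = 0" using q(2) ap by (metis mult.assoc mult_zero_left)
  \<comment> \<open>The correction vanishes on the kernel of \<open>q\<close>. Since
    \<open>i * q * j = p\<close> and \<open>j * p = j\<close>, it sends \<open>j\<close> to
    \<open>j - a * j\<close>, so \<open>b\<close> fixes \<open>j\<close>.\<close>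
  define b where "b = a + (1 - a) * j * i * q"
  show False
  proof (rule r_Fix_irreducible_no_idempotent_factor[OF df reg irr])
    show id: "(1 - q) * (1 - q) = 1 - q" using q by (simp add: algebra_simps)
    show "1 - q \<noteq> 1" using q p0 by auto
    show "1 - q \<noteq> a" using id nid by auto
    show "(1 - q) * x = x" if "a * x = x" for x
    proof -
      have "q * x = 0" using that f_fix q(4) by (metis mult.assoc mult_zero_left)
      then show ?thesis by (simp add: left_diff_distrib)
    qed
    have "q * (1 - q) = 0" using q by (simp add: right_diff_distrib)
    then show "b * (1 - q) = a"
      unfolding b_def using aq by (simp add: distrib_right mult.assoc) (simp add: right_diff_distrib)
    have "y0 * (1 - a) = y0" using y0 by (simp add: right_diff_distrib)
    then have "y0 * b = 0" unfolding b_def using y0 y0j by (simp add: distrib_left flip: mult.assoc)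
    then show "(\<exists>x. x \<noteq> 0 \<and> b * x = 0) \<or> (\<exists>y. y \<noteq> 0 \<and> y * b = 0)" using y0 by blast
    have "(1 - a) * j * i * q * j = (1 - a) * j" using q(5) j(1) by (simp add: mult.assoc)
    then show "b * j = j" unfolding b_def by (simp add: distrib_right left_diff_distrib)
    show "a * j \<noteq> j" using f_fix[of j] j by auto
  qed
qed

theorem theorem5p7:
  fixes a :: "'a::ring_1"
  assumes "dedekind_finite TYPE('a)"
    and "von_neumann_regular TYPE('a)"
    and "comparability_axiom TYPE('a)"
    and "r_Fix_irreducible a"
  shows "coprimitive_idempotent a"
  unfolding coprimitive_idempotent_def
  using r_Fix_irreducible_idempotent[OF assms]
    r_Fix_irreducible_r_ann_indecomposable[OF assms(1,2,4)] by simp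

end
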